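(* Let $K$ be a compact Hausdorff zero-dimensional space without isolated points, and let $L$ be any compactification of $\omega$, i.e. a compact Hausdorff space that has a countably infinite dense set of isolated points (identified with $\omega$). Then $$d_{\rm BM}\big(C(K),C(L)\big)\ \ge\ 3+2\sqrt{2}.$$
   Context: $C(K)$ denotes the Banach space of real-valued continuous functions on a compact Hausdorff space $K$ with the supremum norm. For Banach spaces $X,Y$, the Banach-Mazur distance $d_{\rm BM}(X,Y)$ is the infimum of $\|T\|\cdot\|T^{-1}\|$ over all linear isomorphisms (linear homeomorphisms) $T:X\to Y$ onto $Y$, with the convention that it is $+\infty$ if no such isomorphism exists. Zero-dimensional means having a base of clopen sets. $\omega$ is the (discrete) set of natural numbers. *)

theory Defs
  imports "HOL-Analysis.Analysis"
begin

text \<open>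
  For a compact space \<open>K\<close>, given by a topological type \<open>'k\<close> with \<open>compact (UNIV :: 'k set)\<close>, every
  continuous real function is bounded, so the Banach space \<open>C(K)\<close> with the supremum norm is the
  library type \<open>'k \<Rightarrow>\<^sub>C real\<close>.
\<close>

definition zero_dimensional :: "'k::topological_space itself \<Rightarrow> bool" where
  "zero_dimensional _ \<longleftrightarrow>
     (\<exists>B :: 'k set set. topological_basis B \<and> (\<forall>U\<in>B. open U \<and> closed U))"

definition linear_homeomorphisms :: "('x::real_normed_vector \<Rightarrow> 'y::real_normed_vector) set" where
  "linear_homeomorphisms = {T. bounded_linear T \<and> bij T \<and> bounded_linear (inv T)}"

text \<open>
  The sort is \<open>real_normed_vector\<close> and not \<open>banach\<close> because the library declares \<open>'k \<Rightarrow>\<^sub>C real\<close>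
  an instance of \<open>complete_space\<close> only for metric \<open>'k\<close>; completeness plays no role in the definition.
  The infimum is taken in \<open>ereal\<close>, where the infimum of the empty set is \<open>\<infinity>\<close>.
\<close>

definition banach_mazur_dist :: "'x::real_normed_vector itself \<Rightarrow> 'y::real_normed_vector itself \<Rightarrow> ereal" where
  "banach_mazur_dist _ _ =
     (INF T \<in> (linear_homeomorphisms :: ('x \<Rightarrow> 'y) set). ereal (onorm T * onorm (inv T)))"

end

theory Submission
  imports Defs
begin

text \<open>
  Let \<open>T : C(K) \<rightarrow> C(L)\<close> be an isomorphism with inverse \<open>S\<close>, and let \<open>r\<close> be the supremum of the
  norms \<open>\<parallel>S g\<parallel>\<close> over the \<open>g\<close> in the unit ball of \<open>C(L)\<close> that are supported on finitely many isolated
  points. Choose \<open>g\<close> such that \<open>S g\<close> is almost \<open>r\<close> on a nonempty open set, and in that set a clopen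
  \<open>V\<close> such that \<open>T \<chi>\<^sub>V\<close> is almost \<open>0\<close> on the finite support of \<open>g\<close>; this is possible because \<open>K\<close> has
  no isolated points. Then \<open>T \<chi>\<^sub>V\<close> and \<open>g\<close> are almost disjoint, and applying \<open>S\<close> to
  \<open>T \<chi>\<^sub>V / \<parallel>T \<chi>\<^sub>V\<parallel> + g\<close> yields \<open>1 / \<parallel>T \<chi>\<^sub>V\<parallel> + r \<le> \<parallel>S\<parallel>\<close> up to a small error. So there is an isolated
  point \<open>m\<close> outside the support of \<open>g\<close> with \<open>\<bar>T \<chi>\<^sub>V m\<bar> \<ge> 1 / (\<parallel>S\<parallel> - r)\<close>, almost. By the choice
  of \<open>r\<close> we have \<open>\<bar>S g\<bar> + \<bar>S e\<^sub>m\<bar> \<le> r\<close>, so \<open>S e\<^sub>m\<close> is almost \<open>0\<close> on \<open>V\<close>, and the function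
  \<open>2 \<chi>\<^sub>V - S g / r \<plusminus> S e\<^sub>m / r\<close> has norm almost at most \<open>1\<close>. Its image under \<open>T\<close> has absolute value
  \<open>2 \<bar>T \<chi>\<^sub>V m\<bar> + 1 / r\<close> at \<open>m\<close>. Hence \<open>\<parallel>T\<parallel> \<ge> 2 / (\<parallel>S\<parallel> - r) + 1 / r\<close>, and the bound follows by
  minimizing over \<open>r\<close>.
\<close>

section \<open>Cutting functions off along clopen sets, and pointwise estimates\<close>

definition bcontfun_restrict :: "'a::topological_space set \<Rightarrow> ('a \<Rightarrow>\<^sub>C real) \<Rightarrow> ('a \<Rightarrow>\<^sub>C real)" where
  "bcontfun_restrict V f = Bcontfun (\<lambda>x. if x \<in> V then f x else 0)"

abbreviation bcontfun_indicator :: "'a::topological_space set \<Rightarrow> ('a \<Rightarrow>\<^sub>C real)" where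
  "bcontfun_indicator V \<equiv> bcontfun_restrict V (const_bcontfun 1)"

lemma apply_bcontfun_restrict:
  fixes f :: "'a::topological_space \<Rightarrow>\<^sub>C real"
  assumes "open V" "closed V"
  shows "bcontfun_restrict V f x = (if x \<in> V then f x else 0)"
proof -
  have "continuous_on (V \<union> - V) (\<lambda>x. if x \<in> V then f x else 0)"
    using assms by (intro continuous_on_cases) auto
  then have "continuous_on UNIV (\<lambda>x. if x \<in> V then f x else 0)"
    by simp
  moreover have "norm (if x \<in> V then f x else 0) \<le> norm f" for x
    using norm_bounded[of f x] by auto
  ultimately have "(\<lambda>x. if x \<in> V then f x else 0) \<in> bcontfun"
    by (rule bcontfun_normI)
  then show ?thesis
    unfolding bcontfun_restrict_def by (simp add: Bcontfun_inverse)
qed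

lemma apply_bcontfun_sum:
  fixes f :: "'i \<Rightarrow> 'a::topological_space \<Rightarrow>\<^sub>C real"
  shows "apply_bcontfun (\<Sum>i\<in>I. f i) x = (\<Sum>i\<in>I. f i x)"
  by (induction I rule: infinite_finite_induct) auto

lemma abs_apply_le_onorm:
  fixes T :: "'x::real_normed_vector \<Rightarrow> ('a::topological_space \<Rightarrow>\<^sub>C real)"
  assumes "bounded_linear T"
  shows "\<bar>T f x\<bar> \<le> onorm T * norm f"
  using norm_bounded[of "T f" x] onorm[OF assms, of f] by simp

lemma norm_le_on_dense:
  fixes h :: "'a::topological_space \<Rightarrow>\<^sub>C real"
  assumes "closure D = UNIV" "\<And>x. x \<in> D \<Longrightarrow> \<bar>h x\<bar> \<le> c"
  shows "norm h \<le> c"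
proof (rule norm_bound)
  fix x
  have "continuous_on UNIV (\<lambda>x. \<bar>h x\<bar>)"
    by (intro continuous_intros) auto
  then have "closed {x. \<bar>h x\<bar> \<le> c}"
    by (intro closed_Collect_le) auto
  moreover have "D \<subseteq> {x. \<bar>h x\<bar> \<le> c}"
    using assms(2) by auto
  ultimately have "closure D \<subseteq> {x. \<bar>h x\<bar> \<le> c}"
    by (rule closure_minimal[rotated])
  then show "norm (h x) \<le> c"
    using assms(1) by auto
qed

section \<open>Clopen sets whose indicators have small images on a finite set\<close>

text \<open>Since no point is isolated, \<open>W\<close> contains two points, which have disjoint
  open neighbourhoods. One neighbourhood supplies a clopen set and the other leaves room for the
  induction.\<close>

lemma disjoint_clopen_family:
  fixes W :: "'k::t2_space set"
  assumes "zero_dimensional TYPE('k)" "\<And>x::'k. \<not> x isolated_in UNIV" "open W" "W \<noteq> {}"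
  shows "\<exists>\<V>. finite \<V> \<and> card \<V> = N \<and> disjoint \<V> \<and>
           (\<forall>V\<in>\<V>. open V \<and> closed V \<and> V \<noteq> {} \<and> V \<subseteq> W)"
  using assms(3,4)
proof (induction N arbitrary: W)
  case 0
  show ?case by (intro exI[of _ "{}"]) auto
next
  case (Suc N)
  obtain B :: "'k set set" where B: "topological_basis B" "\<And>U. U \<in> B \<Longrightarrow> open U \<and> closed U"
    using assms(1) unfolding zero_dimensional_def by blast
  obtain p where p: "p \<in> W" using Suc.prems by blast
  have "W \<noteq> {p}"
    using assms(2)[of p] Suc.prems(1) unfolding isolated_in_def by auto
  then obtain q where q: "q \<in> W" "p \<noteq> q" using p by blast
  obtain U1 U2 where U: "open U1" "open U2" "p \<in> U1" "q \<in> U2" "U1 \<inter> U2 = {}"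
    using hausdorff[OF q(2)] by blast
  obtain V where V: "V \<in> B" "p \<in> V" "V \<subseteq> W \<inter> U1"
    using topological_basisE[OF B(1), of "W \<inter> U1" p] U p Suc.prems by blast
  obtain \<V> where \<V>: "finite \<V>" "card \<V> = N" "disjoint \<V>"
      "\<forall>V\<in>\<V>. open V \<and> closed V \<and> V \<noteq> {} \<and> V \<subseteq> W \<inter> U2"
    using Suc.IH[of "W \<inter> U2"] U q Suc.prems by blast
  have disj: "V \<inter> V' = {}" if "V' \<in> \<V>" for V'
    using that \<V>(4) V(3) U(5) by blast
  then have "V \<notin> \<V>" using V(2) by blast
  moreover have "disjoint (insert V \<V>)"
    using \<V>(3) disj by (auto simp: pairwise_insert disjnt_def Int_commute)
  ultimately show ?case
    using \<V> V B(2)[OF V(1)] by (intro exI[of _ "insert V \<V>"]) auto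
qed

text \<open>Weight each indicator with the sign of its image at \<open>n\<close>. Disjointness keeps
  the weighted sum in the unit ball, and its image at \<open>n\<close> is the sum of the absolute
  values.\<close>

lemma sum_abs_disjoint_indicators_le:
  fixes T :: "('k::topological_space \<Rightarrow>\<^sub>C real) \<Rightarrow> ('l::topological_space \<Rightarrow>\<^sub>C real)"
  assumes T: "bounded_linear T" and "finite \<V>" "disjoint \<V>"
    and clopen: "\<And>V. V \<in> \<V> \<Longrightarrow> open V \<and> closed V"
  shows "(\<Sum>V\<in>\<V>. \<bar>T (bcontfun_indicator V) n\<bar>) \<le> onorm T"
proof -
  define f where
    "f = (\<Sum>V\<in>\<V>. sgn (T (bcontfun_indicator V) n) *\<^sub>R (bcontfun_indicator V :: 'k \<Rightarrow>\<^sub>C real))"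
  have "norm f \<le> 1"
  proof (rule norm_bound)
    fix x
    have fx: "f x = (\<Sum>V\<in>\<V>. sgn (T (bcontfun_indicator V) n) * (if x \<in> V then 1 else 0))"
      unfolding f_def using clopen by (simp add: apply_bcontfun_sum apply_bcontfun_restrict cong: if_cong)
    show "norm (f x) \<le> 1"
    proof (cases "\<exists>V\<in>\<V>. x \<in> V")
      case True
      then obtain V where V: "V \<in> \<V>" "x \<in> V" by blast
      have "f x = (\<Sum>V'\<in>\<V>. if V' = V then sgn (T (bcontfun_indicator V) n) else 0)"
        unfolding fx using V \<open>disjoint \<V>\<close>
        by (intro sum.cong) (auto simp: disjoint_def)
      then show ?thesis
        using V \<open>finite \<V>\<close> by (auto simp: sgn_if)
    next
      case False
      then have "f x = 0" unfolding fx by (intro sum.neutral) auto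
      then show ?thesis by simp
    qed
  qed
  have "(\<Sum>V\<in>\<V>. \<bar>T (bcontfun_indicator V) n\<bar>) = T f n"
    unfolding f_def
    by (simp add: linear_sum[OF bounded_linear.linear[OF T]] linear_scale[OF bounded_linear.linear[OF T]]
        apply_bcontfun_sum abs_sgn mult.commute)
  also have "\<dots> \<le> onorm T * norm f"
    using abs_apply_le_onorm[OF T, of f n] by linarith
  also have "\<dots> \<le> onorm T"
    using \<open>norm f \<le> 1\<close> onorm_pos_le[OF T] by (simp add: mult_left_le)
  finally show ?thesis .
qed

text \<open>A counting argument: if all \<open>N\<close> disjoint clopen sets failed, their images
  would have total mass at least \<open>N * \<epsilon>\<close> over \<open>F\<close>, whereas each
  point of \<open>F\<close> carries at most \<open>onorm T\<close>.\<close>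

lemma small_image_indicator:
  fixes T :: "('k::t2_space \<Rightarrow>\<^sub>C real) \<Rightarrow> ('l::topological_space \<Rightarrow>\<^sub>C real)"
  assumes K: "zero_dimensional TYPE('k)" "\<And>x::'k. \<not> x isolated_in UNIV"
    and "open W" "W \<noteq> {}" and T: "bounded_linear T" and "finite F" "\<epsilon> > 0"
  obtains V where "open V" "closed V" "V \<noteq> {}" "V \<subseteq> W"
    "\<And>n. n \<in> F \<Longrightarrow> \<bar>T (bcontfun_indicator V) n\<bar> \<le> \<epsilon>"
proof -
  obtain N :: nat where N: "onorm T * card F < N * \<epsilon>"
    using \<open>\<epsilon> > 0\<close> reals_Archimedean3 by blast
  obtain \<V> where \<V>: "finite \<V>" "card \<V> = N" "disjoint \<V>"
      "\<forall>V\<in>\<V>. open V \<and> closed V \<and> V \<noteq> {} \<and> V \<subseteq> W"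
    using disjoint_clopen_family[OF K \<open>open W\<close> \<open>W \<noteq> {}\<close>] by blast
  have "\<exists>V\<in>\<V>. \<forall>n\<in>F. \<bar>T (bcontfun_indicator V) n\<bar> \<le> \<epsilon>"
  proof (rule ccontr)
    assume "\<not> ?thesis"
    then have big: "\<exists>n\<in>F. \<epsilon> < \<bar>T (bcontfun_indicator V) n\<bar>" if "V \<in> \<V>" for V
      using that by force
    have "N * \<epsilon> = (\<Sum>V\<in>\<V>. \<epsilon>)"
      using \<V>(2) by simp
    also have "\<dots> \<le> (\<Sum>V\<in>\<V>. \<Sum>n\<in>F. \<bar>T (bcontfun_indicator V) n\<bar>)"
    proof (rule sum_mono)
      fix V assume "V \<in> \<V>"
      then obtain n where n: "n \<in> F" "\<epsilon> < \<bar>T (bcontfun_indicator V) n\<bar>"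
        using big by blast
      then show "\<epsilon> \<le> (\<Sum>n\<in>F. \<bar>T (bcontfun_indicator V) n\<bar>)"
        using member_le_sum[OF n(1), of "\<lambda>n. \<bar>T (bcontfun_indicator V) n\<bar>"] \<open>finite F\<close> by simp
    qed
    also have "\<dots> = (\<Sum>n\<in>F. \<Sum>V\<in>\<V>. \<bar>T (bcontfun_indicator V) n\<bar>)"
      by (rule sum.swap)
    also have "\<dots> \<le> (\<Sum>n\<in>F. onorm T)"
      using \<V> by (intro sum_mono sum_abs_disjoint_indicators_le[OF T]) auto
    finally show False
      using N by (simp add: mult.commute)
  qed
  then show ?thesis
    using that \<V>(4) by blast
qed

section \<open>Finitely supported functions on the isolated points\<close>

definition finitely_supported_ball :: "'l::topological_space set \<Rightarrow> ('l \<Rightarrow>\<^sub>C real) set" where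
  "finitely_supported_ball D =
     {g. norm g \<le> 1 \<and> finite {y. apply_bcontfun g y \<noteq> 0} \<and> {y. apply_bcontfun g y \<noteq> 0} \<subseteq> D}"

lemma apply_bcontfun_point:
  fixes m :: "'l::t2_space"
  assumes "m isolated_in UNIV"
  shows "bcontfun_indicator {m} x = (if x = m then 1 else 0)"
  using assms apply_bcontfun_restrict[of "{m}"] by (auto simp: isolated_in_def)

text \<open>As \<open>g\<close> vanishes at \<open>m\<close>, any combination of \<open>g\<close>
  and the point indicator with coefficients 1 or -1 stays in the ball. The signs are chosen so that
  both images count positively at \<open>x\<close>.\<close>

lemma abs_add_abs_image_point_le:
  fixes S :: "('l::t2_space \<Rightarrow>\<^sub>C real) \<Rightarrow> ('k::topological_space \<Rightarrow>\<^sub>C real)"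
  assumes S: "linear S" and m: "m \<in> D" "m isolated_in UNIV"
    and le: "\<And>g x. g \<in> finitely_supported_ball D \<Longrightarrow> S g x \<le> r"
    and g: "g \<in> finitely_supported_ball D" "g m = 0"
  shows "\<bar>S g x\<bar> + \<bar>S (bcontfun_indicator {m}) x\<bar> \<le> r"
proof -
  define a where "a = (if S g x \<ge> 0 then 1 else - 1 :: real)"
  define b where "b = (if S (bcontfun_indicator {m}) x \<ge> 0 then 1 else - 1 :: real)"
  define g' where "g' = a *\<^sub>R g + b *\<^sub>R bcontfun_indicator {m}"
  have ev: "g' y = (if y = m then b else a * g y)" for y
    using g(2) apply_bcontfun_point[OF m(2)] by (simp add: g'_def)
  have "\<bar>g' y\<bar> \<le> 1" for y
    using norm_bounded[of g y] g(1)
    by (auto simp: ev a_def b_def finitely_supported_ball_def)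
  then have "norm g' \<le> 1"
    by (intro norm_bound) simp
  moreover have "{y. g' y \<noteq> 0} \<subseteq> insert m {y. g y \<noteq> 0}"
    by (auto simp: ev)
  ultimately have "g' \<in> finitely_supported_ball D"
    using g(1) m(1) finite_subset[of _ "insert m {y. g y \<noteq> 0}"]
    unfolding finitely_supported_ball_def by blast
  then have "S g' x \<le> r" by (rule le)
  also have "S g' x = \<bar>S g x\<bar> + \<bar>S (bcontfun_indicator {m}) x\<bar>"
    by (simp add: g'_def linear_add[OF S] linear_scale[OF S] a_def b_def)
  finally show ?thesis .
qed

section \<open>The main estimate, up to an error\<close>

text \<open>The bound on \<open>onorm T\<close> is stated multiplied by
  \<open>onorm S - r + \<epsilon>\<close>, so that the limit \<epsilon> to 0 can be taken before
  \<open>onorm S = r\<close> is excluded.\<close>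

lemma approximate_norm_bound:
  fixes T :: "('k::t2_space \<Rightarrow>\<^sub>C real) \<Rightarrow> ('l::t2_space \<Rightarrow>\<^sub>C real)"
  assumes K: "zero_dimensional TYPE('k)" "\<And>x::'k. \<not> x isolated_in UNIV"
    and isol: "\<And>x. x \<in> D \<Longrightarrow> x isolated_in UNIV" and dense: "closure D = UNIV"
    and T: "bounded_linear T" and S: "bounded_linear S"
    and TS: "\<And>g. T (S g) = g" and ST: "\<And>f. S (T f) = f"
    and "r > 0" and le: "\<And>g x. g \<in> finitely_supported_ball D \<Longrightarrow> S g x \<le> r"
    and g: "g \<in> finitely_supported_ball D" "S g x0 > r - \<epsilon>"
    and \<epsilon>: "0 < \<epsilon>" "\<epsilon> < 1" "\<epsilon> * onorm S < 1"
  shows "2 * (1 - \<epsilon>) * (1 - \<epsilon> * onorm S) + (onorm S - r + \<epsilon>) / r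
           \<le> onorm T * (1 + 2 * \<epsilon> / r) * (onorm S - r + \<epsilon>)"
proof -
  note linS = bounded_linear.linear[OF S] and linT = bounded_linear.linear[OF T]
  define F where "F = {y. g y \<noteq> 0}"
  have F: "finite F" "F \<subseteq> D"
    using g by (auto simp: finitely_supported_ball_def F_def)
  have clopenF: "open F" "closed F"
  proof -
    have "open (\<Union>y\<in>F. {y})"
      using isol F(2) by (intro open_UN) (auto simp: isolated_in_def)
    then show "open F" by simp
    show "closed F" using F(1) by (rule finite_imp_closed)
  qed
  define W where "W = {x. S g x > r - \<epsilon>}"
  have "open W"
    unfolding W_def by (intro open_Collect_less) auto
  moreover have "W \<noteq> {}" using g(2) by (auto simp: W_def)
  ultimately obtain V where V: "open V" "closed V" "V \<noteq> {}" "V \<subseteq> W"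
      and small: "\<And>n. n \<in> F \<Longrightarrow> \<bar>T (bcontfun_indicator V) n\<bar> \<le> \<epsilon>"
    using small_image_indicator[OF K _ _ T F(1) \<epsilon>(1)] by metis
  define v where "v = (bcontfun_indicator V :: 'k \<Rightarrow>\<^sub>C real)"
  have v: "v x = (if x \<in> V then 1 else 0)" for x
    using V by (simp add: v_def apply_bcontfun_restrict)
  obtain x where x: "x \<in> V" using V(3) by blast
  \<comment> \<open>Split \<open>T v\<close> along the clopen support of \<open>g\<close>: the part
    \<open>k\<close> is small, and the rest \<open>h\<close> is exactly disjoint from
    \<open>g\<close>. Hence \<open>S h\<close> is still almost 1 on \<open>V\<close>.\<close>
  define k where "k = bcontfun_restrict F (T v)"
  define h where "h = T v - k"
  have h: "h y = (if y \<in> F then 0 else T v y)" for y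
    by (simp add: h_def k_def apply_bcontfun_restrict[OF clopenF])
  have "norm k \<le> \<epsilon>"
    using small \<epsilon>(1)
    by (intro norm_bound) (auto simp: k_def apply_bcontfun_restrict[OF clopenF] v_def)
  then have "onorm S * norm k \<le> \<epsilon> * onorm S"
    using onorm_pos_le[OF S] by (subst mult.commute) (rule mult_right_mono)
  then have "\<bar>S k x\<bar> \<le> \<epsilon> * onorm S"
    using abs_apply_le_onorm[OF S, of k x] by linarith
  moreover have "S h x = 1 - S k x"
    using x by (simp add: h_def linear_diff[OF linS] ST v)
  ultimately have Sh: "S h x \<ge> 1 - \<epsilon> * onorm S" by linarith
  have "h \<noteq> 0"
  proof
    assume "h = 0"
    then show False using Sh \<epsilon>(3) linear_0[OF linS] by simp
  qed
  define A where "A = norm h"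
  have A: "A > 0" using \<open>h \<noteq> 0\<close> by (simp add: A_def)
  have "norm ((1 / A) *\<^sub>R h + g) \<le> 1"
  proof (rule norm_bound)
    fix y
    have "\<bar>g y\<bar> \<le> 1"
      using norm_bounded[of g y] g(1) by (simp add: finitely_supported_ball_def)
    moreover have "\<bar>h y\<bar> / A \<le> 1"
      using norm_bounded[of h y] A by (simp add: A_def)
    moreover have "h y = 0 \<or> g y = 0"
      by (auto simp: h F_def)
    ultimately show "norm (((1 / A) *\<^sub>R h + g) y) \<le> 1"
      using A by auto
  qed
  then have "onorm S * norm ((1 / A) *\<^sub>R h + g) \<le> onorm S"
    using onorm_pos_le[OF S] by (simp add: mult_left_le)
  then have "S ((1 / A) *\<^sub>R h + g) x \<le> onorm S"
    using abs_apply_le_onorm[OF S, of "(1 / A) *\<^sub>R h + g" x] by linarith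
  then have "S h x / A + S g x \<le> onorm S"
    by (simp add: linear_add[OF linS] linear_scale[OF linS])
  moreover have "S g x > r - \<epsilon>"
    using x V(4) by (auto simp: W_def)
  ultimately have "S h x / A \<le> onorm S - r + \<epsilon>" by linarith
  then have hA: "1 - \<epsilon> * onorm S \<le> (onorm S - r + \<epsilon>) * A"
    using Sh A by (simp add: divide_le_eq)
  then have pos: "onorm S - r + \<epsilon> > 0"
    using \<epsilon>(3) A zero_less_mult_pos2[of "onorm S - r + \<epsilon>" A] by linarith

  \<comment> \<open>By density, \<open>h\<close> almost attains its norm at an isolated point. As
    \<open>h\<close> is zero on \<open>F\<close>, that point lies outside the support of
    \<open>g\<close>.\<close>
  have "\<exists>m\<in>D. \<bar>h m\<bar> > (1 - \<epsilon>) * A"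
  proof (rule ccontr)
    assume "\<not> ?thesis"
    then have "A \<le> (1 - \<epsilon>) * A"
      unfolding A_def by (intro norm_le_on_dense[OF dense]) force
    then show False using mult_pos_pos[OF A \<epsilon>(1)] by (simp add: algebra_simps)
  qed
  then obtain m where m: "m \<in> D" "\<bar>h m\<bar> > (1 - \<epsilon>) * A" by blast
  have "0 \<le> (1 - \<epsilon>) * A" using A \<epsilon>(2) by simp
  then have "m \<notin> F" using m(2) by (auto simp: h)
  then have gm: "g m = 0" and Tv: "\<bar>T v m\<bar> > (1 - \<epsilon>) * A"
    using m(2) by (auto simp: h F_def)
  define e where "e = (bcontfun_indicator {m} :: 'l \<Rightarrow>\<^sub>C real)"
  have sum_le: "\<bar>S g y\<bar> + \<bar>S e y\<bar> \<le> r" for y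
    unfolding e_def
    by (rule abs_add_abs_image_point_le[OF linS m(1) isol[OF m(1)] le g(1) gm])
  \<comment> \<open>This sign prevents cancellation between the two terms of
    \<open>T \<phi> m = 2 * T v m + t / r\<close>.\<close>
  define t where "t = (if T v m \<ge> 0 then 1 else - 1 :: real)"
  define \<phi> where "\<phi> = 2 *\<^sub>R v - (1 / r) *\<^sub>R S g + (t / r) *\<^sub>R S e"
  \<comment> \<open>The last two terms of \<phi> together lie in [-1, 1]. On \<open>V\<close> they
    lie within \<open>2 * \<epsilon> / r\<close> of -1, which compensates for the value 2 of the
    first term.\<close>
  have "norm \<phi> \<le> 1 + 2 * \<epsilon> / r"
  proof (rule norm_bound)
    fix y
    have \<phi>y: "\<phi> y = 2 * v y + (t * S e y - S g y) / r"
      by (simp add: \<phi>_def diff_divide_distrib)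
    have te: "\<bar>t * S e y\<bar> = \<bar>S e y\<bar>"
      by (simp add: t_def)
    have "\<bar>t * S e y - S g y\<bar> \<le> r"
      using sum_le[of y] te by linarith
    then have 1: "\<bar>(t * S e y - S g y) / r\<bar> \<le> 1"
      using \<open>r > 0\<close> by simp
    show "norm (\<phi> y) \<le> 1 + 2 * \<epsilon> / r"
    proof (cases "y \<in> V")
      case True
      then have "S g y > r - \<epsilon>" using V(4) by (auto simp: W_def)
      \<comment> \<open>One \<epsilon> comes from \<open>S g y > r - \<epsilon>\<close>; the other
        from \<open>\<bar>S e y\<bar> < \<epsilon>\<close>, which follows by
        \<open>sum_le\<close>.\<close>
      then have "t * S e y - S g y \<le> 2 * \<epsilon> - r"
        using sum_le[of y] te by linarith
      then have "(t * S e y - S g y) / r \<le> (2 * \<epsilon> - r) / r"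
        using \<open>r > 0\<close> by (intro divide_right_mono) auto
      then have "(t * S e y - S g y) / r \<le> 2 * \<epsilon> / r - 1"
        using \<open>r > 0\<close> by (simp add: diff_divide_distrib)
      then show ?thesis
        using 1 True unfolding real_norm_def \<phi>y v by (simp only: if_True)
    next
      case False
      moreover have "2 * \<epsilon> / r > 0" using \<epsilon> \<open>r > 0\<close> by simp
      ultimately show ?thesis
        using 1 unfolding real_norm_def \<phi>y v by (simp only: if_False)
    qed
  qed
  then have "onorm T * norm \<phi> \<le> onorm T * (1 + 2 * \<epsilon> / r)"
    using onorm_pos_le[OF T] by (simp add: mult_left_mono)
  moreover have "T \<phi> m = 2 * T v m + t / r"
    using gm apply_bcontfun_point[OF isol[OF m(1)], of m]
    by (simp add: \<phi>_def linear_add[OF linT] linear_diff[OF linT] linear_scale[OF linT] TS e_def)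
  then have "\<bar>T \<phi> m\<bar> = 2 * \<bar>T v m\<bar> + 1 / r"
    using divide_pos_pos[OF zero_less_one \<open>r > 0\<close>] unfolding t_def
    by (cases "T v m \<ge> 0") (simp, simp del: zero_less_divide_1_iff)
  ultimately have "2 * ((1 - \<epsilon>) * A) + 1 / r \<le> onorm T * (1 + 2 * \<epsilon> / r)"
    using abs_apply_le_onorm[OF T, of \<phi> m] Tv by linarith
  \<comment> \<open>Multiplying by this positive factor lets \<open>hA\<close> eliminate
    \<open>A\<close>.\<close>
  then have "(2 * ((1 - \<epsilon>) * A) + 1 / r) * (onorm S - r + \<epsilon>)
               \<le> onorm T * (1 + 2 * \<epsilon> / r) * (onorm S - r + \<epsilon>)"
    using pos by (intro mult_right_mono) auto
  moreover have "(2 * ((1 - \<epsilon>) * A) + 1 / r) * (onorm S - r + \<epsilon>) =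
      2 * (1 - \<epsilon>) * ((onorm S - r + \<epsilon>) * A) + (onorm S - r + \<epsilon>) / r"
    using \<open>r > 0\<close> by (simp add: field_simps)
  moreover have "2 * (1 - \<epsilon>) * (1 - \<epsilon> * onorm S) \<le> 2 * (1 - \<epsilon>) * ((onorm S - r + \<epsilon>) * A)"
    using hA \<epsilon>(2) by (intro mult_left_mono) auto
  ultimately show ?thesis by linarith
qed

section \<open>Passing to the limit and minimizing over \<open>r\<close>\<close>

text \<open>The product equals 3 + p/r + 2r/p, so this is the inequality of arithmetic and geometric
  means, with equality at \<open>p = sqrt 2 * r\<close>. It is applied with
  \<open>p = onorm S - r\<close>.\<close>

lemma sum_times_weighted_inverses_ge:
  fixes p r :: real
  assumes "p > 0" "r > 0"
  shows "3 + 2 * sqrt 2 \<le> (p + r) * (2 / p + 1 / r)"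
proof -
  have "0 \<le> (p - sqrt 2 * r)\<^sup>2" by simp
  also have "\<dots> = p\<^sup>2 + 2 * r\<^sup>2 - 2 * sqrt 2 * (p * r)"
    by (simp add: power2_diff power_mult_distrib)
  finally have "2 * sqrt 2 * (p * r) \<le> p\<^sup>2 + 2 * r\<^sup>2" by simp
  then have "2 * sqrt 2 \<le> (p\<^sup>2 + 2 * r\<^sup>2) / (p * r)"
    using assms by (simp add: le_divide_eq)
  also have "\<dots> = (p + r) * (2 / p + 1 / r) - 3"
    using assms by (simp add: field_simps power2_eq_square)
  finally show ?thesis by simp
qed

lemma onorm_times_onorm_inverse_ge:
  fixes T :: "('k::t2_space \<Rightarrow>\<^sub>C real) \<Rightarrow> ('l::t2_space \<Rightarrow>\<^sub>C real)"
    and D :: "'l set"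
  assumes K: "zero_dimensional TYPE('k)" "\<And>x::'k. \<not> x isolated_in UNIV"
    and isol: "\<And>x. x \<in> D \<Longrightarrow> x isolated_in UNIV" and dense: "closure D = UNIV"
    and T: "bounded_linear T" and S: "bounded_linear S"
    and TS: "\<And>g. T (S g) = g" and ST: "\<And>f. S (T f) = f"
  shows "3 + 2 * sqrt 2 \<le> onorm T * onorm S"
proof -
  note linS = bounded_linear.linear[OF S] and linT = bounded_linear.linear[OF T]
  let ?X = "{S g x | g x. g \<in> finitely_supported_ball D}"
  \<comment> \<open>The ball is symmetric, so this is also the supremum of
    \<open>norm (S g)\<close>.\<close>
  define r where "r = Sup ?X"
  have bound: "S g x \<le> onorm S" if "g \<in> finitely_supported_ball D" for g x
  proof -
    have "onorm S * norm g \<le> onorm S"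
      using that onorm_pos_le[OF S] by (simp add: mult_left_le finitely_supported_ball_def)
    then show ?thesis
      using abs_apply_le_onorm[OF S, of g x] by linarith
  qed
  then have bdd: "bdd_above ?X" by (intro bdd_aboveI[of _ "onorm S"]) auto
  then have le: "S g x \<le> r" if "g \<in> finitely_supported_ball D" for g x
    unfolding r_def using that by (intro cSup_upper) auto
  have zero: "0 \<in> finitely_supported_ball D" by (simp add: finitely_supported_ball_def)
  have "D \<noteq> {}" using dense by auto
  then obtain m where m: "m \<in> D" by blast
  define e where "e = (bcontfun_indicator {m} :: 'l \<Rightarrow>\<^sub>C real)"
  \<comment> \<open>Otherwise the sum estimate with \<open>g = 0\<close> gives
    \<open>S e = 0\<close>, against the injectivity of \<open>S\<close>.\<close>
  have "r > 0"
  proof (rule ccontr)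
    assume "\<not> r > 0"
    then have "S e x = 0" for x
      using abs_add_abs_image_point_le[OF linS m isol[OF m] le zero, of x]
      unfolding e_def by fastforce
    then have "S e = 0" by (intro bcontfun_eqI) simp
    then have "e = 0" using TS[of e] linear_0[OF linT] by simp
    then show False
      using apply_bcontfun_point[OF isol[OF m], of m] by (simp add: e_def)
  qed
  have "r \<le> onorm S"
    unfolding r_def using bound zero by (intro cSup_least) auto
  let ?lhs = "\<lambda>\<epsilon>. 2 * (1 - \<epsilon>) * (1 - \<epsilon> * onorm S) + (onorm S - r + \<epsilon>) / r"
  let ?rhs = "\<lambda>\<epsilon>. onorm T * (1 + 2 * \<epsilon> / r) * (onorm S - r + \<epsilon>)"
  have approx: "?lhs \<epsilon> \<le> ?rhs \<epsilon>" if \<epsilon>: "0 < \<epsilon>" "\<epsilon> < 1" "\<epsilon> * onorm S < 1" for \<epsilon>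
  proof -
    have "\<exists>y\<in>?X. r - \<epsilon> < y"
      using \<epsilon>(1) zero bdd unfolding r_def by (intro less_cSupD) auto
    then obtain g x where "g \<in> finitely_supported_ball D" "S g x > r - \<epsilon>" by blast
    then show ?thesis
      using approximate_norm_bound[OF K isol dense T S TS ST \<open>r > 0\<close> le _ _ \<epsilon>] by blast
  qed
  have ev: "\<forall>\<^sub>F \<epsilon> in at_right 0. ?lhs \<epsilon> \<le> ?rhs \<epsilon>"
  proof -
    have "((\<lambda>\<epsilon>. \<epsilon> * onorm S) \<longlongrightarrow> 0 * onorm S) (at_right (0::real))"
      by (intro tendsto_intros)
    then have "\<forall>\<^sub>F \<epsilon> in at_right (0::real). \<epsilon> * onorm S < 1"
      by (rule order_tendstoD) simp
    moreover have "\<forall>\<^sub>F \<epsilon> in at_right (0::real). 0 < \<epsilon> \<and> \<epsilon> < 1"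
      using eventually_at_right_real[of 0 1] by simp
    ultimately show ?thesis
      by eventually_elim (use approx in blast)
  qed
  have "(?lhs \<longlongrightarrow> 2 * (1 - 0) * (1 - 0 * onorm S) + (onorm S - r + 0) / r) (at_right 0)"
    using \<open>r > 0\<close> by (intro tendsto_intros) auto
  moreover have "(?rhs \<longlongrightarrow> onorm T * (1 + 2 * 0 / r) * (onorm S - r + 0)) (at_right 0)"
    using \<open>r > 0\<close> by (intro tendsto_intros) auto
  ultimately have lim: "2 + (onorm S - r) / r \<le> onorm T * (onorm S - r)"
    using tendsto_le[OF trivial_limit_at_right_real _ _ ev] by fastforce
  define p where "p = onorm S - r"
  \<comment> \<open>For \<open>p = 0\<close> the limit inequality would read 2 \<le> 0.\<close>
  have "p \<noteq> 0" using lim by (auto simp: p_def)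
  then have p: "p > 0" using \<open>r \<le> onorm S\<close> by (simp add: p_def)
  have "2 / p + 1 / r = (2 + p / r) / p"
    using p \<open>r > 0\<close> by (simp add: field_simps)
  also have "\<dots> \<le> onorm T"
    using lim p by (simp add: p_def divide_le_eq)
  finally have "(p + r) * (2 / p + 1 / r) \<le> (p + r) * onorm T"
    using p \<open>r > 0\<close> by (intro mult_left_mono) auto
  then show ?thesis
    using sum_times_weighted_inverses_ge[OF p \<open>r > 0\<close>] by (simp add: p_def mult.commute)
qed

theorem theorem3p1:
  fixes D :: "'l::t2_space set"
  assumes "compact (UNIV :: 'k::t2_space set)"
    and "zero_dimensional TYPE('k)"
    and "\<And>x::'k. \<not> x isolated_in UNIV"
    and "compact (UNIV :: 'l set)"
    and "countable D" and "infinite D"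
    and "\<And>x. x \<in> D \<Longrightarrow> x isolated_in UNIV"
    and "closure D = UNIV"
  shows "banach_mazur_dist TYPE('k \<Rightarrow>\<^sub>C real) TYPE('l \<Rightarrow>\<^sub>C real) \<ge> ereal (3 + 2 * sqrt 2)"
  unfolding banach_mazur_dist_def
proof (rule INF_greatest)
  fix T :: "('k \<Rightarrow>\<^sub>C real) \<Rightarrow> ('l \<Rightarrow>\<^sub>C real)"
  assume "T \<in> linear_homeomorphisms"
  then have T: "bounded_linear T" "bij T" "bounded_linear (inv T)"
    by (auto simp: linear_homeomorphisms_def)
  have "T (inv T g) = g" "inv T (T f) = f" for f g
    using T(2) by (simp_all add: bij_is_surj surj_f_inv_f bij_is_inj)
  then show "ereal (3 + 2 * sqrt 2) \<le> ereal (onorm T * onorm (inv T))"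
    using onorm_times_onorm_inverse_ge[OF assms(2,3,7,8) T(1,3)] by simp
qed

end
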